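(* The minimum number of vertices of a periodic graph $\mathcal{G}$ with cop number $c(\mathcal{G})=3$ is at least $5$ and at most $8$.
   Context: A periodic graph with period $p\ge1$ is a sequence $\mathcal{G}=(G_0,\dots,G_{p-1})$ of finite undirected reflexive graphs $G_i=(V,E_i)$ on a common vertex set $V$ (its vertices), extended by $G_{i+p}=G_i$; its footprint $(V,\bigcup_iE_i)$ is assumed connected. Cops and Robber on $\mathcal{G}$ with $k$ cops (perfect information): cops choose starting vertices, then the robber; in each round $t=0,1,\dots$ each cop moves to a vertex of $N_{G_{t\bmod p}}[\text{its position}]$, then the robber likewise; the cops win if a cop ever moves onto the robber's vertex. The cop number $c(\mathcal{G})$ is the least $k$ such that $k$ cops have a winning strategy. *)

theory Defs
  imports Main
begin

text \<open>
  The list \<open>snapshots\<close> holds the edge relations of \<open>G\<^sub>0, \<dots>, G\<^sub>p\<^sub>-\<^sub>1\<close>; its length is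
  the period \<open>p\<close>.
\<close>

record 'v periodic_graph =
  verts :: "'v set"
  snapshots :: "'v rel list"

definition snapshot_at :: "'v periodic_graph \<Rightarrow> nat \<Rightarrow> 'v rel" where
  "snapshot_at G t = snapshots G ! (t mod length (snapshots G))"

definition footprint :: "'v periodic_graph \<Rightarrow> 'v rel" where
  "footprint G = \<Union> (set (snapshots G))"

definition reflexive_graph_on :: "'v set \<Rightarrow> 'v rel \<Rightarrow> bool" where
  "reflexive_graph_on V E \<longleftrightarrow> E \<subseteq> V \<times> V \<and> refl_on V E \<and> sym E"

definition is_periodic_graph :: "'v periodic_graph \<Rightarrow> bool" where
  "is_periodic_graph G \<longleftrightarrow>
     finite (verts G) \<and> verts G \<noteq> {} \<and>
     length (snapshots G) \<ge> 1 \<and>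
     (\<forall>E\<in>set (snapshots G). reflexive_graph_on (verts G) E) \<and>
     (\<forall>u\<in>verts G. \<forall>v\<in>verts G. (u, v) \<in> (footprint G)\<^sup>*)"

text \<open>
  \<open>r 0\<close> is the robber's starting vertex and \<open>r (Suc t)\<close> its position at the end of
  round \<open>t\<close>. Since the graphs are reflexive, every finite play of the robber extends to
  an infinite walk, so play may be continued formally after a capture.
\<close>

definition robber_walk :: "'v periodic_graph \<Rightarrow> (nat \<Rightarrow> 'v) \<Rightarrow> bool" where
  "robber_walk G r \<longleftrightarrow>
     r 0 \<in> verts G \<and> (\<forall>t. (r t, r (Suc t)) \<in> snapshot_at G t)"

text \<open>
  A strategy maps the robber's history to the list of positions of the cops: \<open>S []\<close> is
  the initial placement, chosen before the robber's, and \<open>S [r 0, \<dots>, r t]\<close> is the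
  placement after the cops' move in round \<open>t\<close>. The cops' own history is determined by
  \<open>S\<close> and the robber's, so this is full perfect-information play.
\<close>

definition cop_strategy ::
    "'v periodic_graph \<Rightarrow> nat \<Rightarrow> ('v list \<Rightarrow> 'v list) \<Rightarrow> bool" where
  "cop_strategy G k S \<longleftrightarrow>
     length (S []) = k \<and> set (S []) \<subseteq> verts G \<and>
     (\<forall>r t. robber_walk G r \<longrightarrow>
        list_all2 (\<lambda>u v. (u, v) \<in> snapshot_at G t)
          (S (map r [0..<t])) (S (map r [0..<Suc t])))"

text \<open>
  Only captures by a move of the cops count. A robber that starts or moves onto a cop's
  vertex is caught in the next move of the cops, because that cop may stay put.
\<close>

definition winning_strategy ::
    "'v periodic_graph \<Rightarrow> nat \<Rightarrow> ('v list \<Rightarrow> 'v list) \<Rightarrow> bool" where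
  "winning_strategy G k S \<longleftrightarrow>
     cop_strategy G k S \<and>
     (\<forall>r. robber_walk G r \<longrightarrow> (\<exists>t. r t \<in> set (S (map r [0..<Suc t]))))"

definition cop_number :: "'v periodic_graph \<Rightarrow> nat" where
  "cop_number G = (LEAST k. \<exists>S. winning_strategy G k S)"

end

theory Submission imports Defs begin

text \<open>
  The extremal example is the cube whose vertices are the subsets of \<open>{0, 1, 2}\<close>, where
  round \<open>t\<close> only allows changing coordinate \<open>t mod 3\<close>. What matters is in which coordinates
  a cop differs from the robber: in each round a cop sets the current one to its liking, and
  the robber may then flip it for all cops at once. Against two cops the robber can always
  keep one of them different in the coordinate just played and the other one different in one
  of the two coordinates that will not be played next; three cops win within four rounds.

  Conversely, let \<open>V = {a, b, c, d}\<close>. If two cops lose, then for each of their six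
  placements on two of these vertices the robber is safe on one of the two others. By the
  pigeonhole principle some \<open>y\<close> is safe against two placements that together cover all
  other vertices. So \<open>y\<close> has no neighbour in the current round, the robber has to stay there if the
  cops wait, and by induction \<open>y\<close> is isolated forever, against the connectedness of the footprint.
\<close>

section \<open>Winning within a bounded number of rounds\<close>

lemma snapshot_at_in_snapshots:
  "is_periodic_graph G \<Longrightarrow> snapshot_at G t \<in> set (snapshots G)"
  unfolding is_periodic_graph_def snapshot_at_def
  by (intro nth_mem mod_less_divisor) linarith

lemma snapshot_at_vertsD:
  assumes "is_periodic_graph G" "(u, v) \<in> snapshot_at G t"
  shows "u \<in> verts G" "v \<in> verts G"
  using snapshot_at_in_snapshots[OF assms(1), of t] assms
  unfolding is_periodic_graph_def reflexive_graph_on_def by blast+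

lemma snapshot_at_refl:
  "is_periodic_graph G \<Longrightarrow> v \<in> verts G \<Longrightarrow> (v, v) \<in> snapshot_at G t"
  using snapshot_at_in_snapshots[of G t]
  unfolding is_periodic_graph_def reflexive_graph_on_def refl_on_def by blast

lemma snapshot_at_sym:
  "is_periodic_graph G \<Longrightarrow> (u, v) \<in> snapshot_at G t \<Longrightarrow> (v, u) \<in> snapshot_at G t"
  using snapshot_at_in_snapshots[of G t]
  unfolding is_periodic_graph_def reflexive_graph_on_def by (auto dest: symD)

lemma list_all2_snapshot_at_refl:
  "is_periodic_graph G \<Longrightarrow> set C \<subseteq> verts G \<Longrightarrow>
     list_all2 (\<lambda>u v. (u, v) \<in> snapshot_at G t) C C"
  by (auto simp: list_all2_same snapshot_at_refl)

lemma list_all2_snapshot_at_verts: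
  "is_periodic_graph G \<Longrightarrow> list_all2 (\<lambda>u v. (u, v) \<in> snapshot_at G t) C C' \<Longrightarrow>
     set C' \<subseteq> verts G"
  by (auto simp: list_all2_conv_all_nth set_conv_nth dest: snapshot_at_vertsD)

lemma robber_walk_verts:
  "is_periodic_graph G \<Longrightarrow> robber_walk G r \<Longrightarrow> r t \<in> verts G"
  by (cases t) (auto simp: robber_walk_def dest: snapshot_at_vertsD)

text \<open>The cops, at \<open>C\<close>, are about to move in round \<open>t\<close> against the
  robber at \<open>x\<close>. Counting their remaining moves by \<open>n\<close> yields a rank that
  a winning strategy can decrease. The value at 0 is \<open>False\<close> even if \<open>x\<close>
  lies in \<open>C\<close>, since only moves capture.\<close>

primrec capture_within ::
    "'v periodic_graph \<Rightarrow> nat \<Rightarrow> nat \<Rightarrow> 'v list \<Rightarrow> 'v \<Rightarrow> bool" where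
  "capture_within G 0 t C x = False"
| "capture_within G (Suc n) t C x =
     (\<exists>C'. list_all2 (\<lambda>u v. (u, v) \<in> snapshot_at G t) C C' \<and>
        (x \<in> set C' \<or> (\<forall>y. (x, y) \<in> snapshot_at G t \<longrightarrow> capture_within G n (Suc t) C' y)))"

lemma capture_within_Suc:
  "capture_within G n t C x \<Longrightarrow> capture_within G (Suc n) t C x"
proof (induction n arbitrary: t C x)
  case (Suc n)
  obtain C' where "list_all2 (\<lambda>u v. (u, v) \<in> snapshot_at G t) C C'"
    "x \<in> set C' \<or> (\<forall>y. (x, y) \<in> snapshot_at G t \<longrightarrow> capture_within G n (Suc t) C' y)"
    using Suc.prems unfolding capture_within.simps(2) by blast
  with Suc.IH show ?case
    unfolding capture_within.simps(2)[of G "Suc n"] by blast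
qed simp

lemma capture_within_mono:
  assumes "capture_within G m t C x" "m \<le> n"
  shows "capture_within G n t C x"
  using assms(2,1) by (induction rule: dec_induct) (simp, rule capture_within_Suc)

text \<open>The cops always choose a move that lowers the least number of rounds sufficient for
  capture.\<close>

lemma winning_strategy_if_capture_within:
  assumes G: "is_periodic_graph G"
    and C0: "length C0 = k" "set C0 \<subseteq> verts G"
    and win: "\<And>x. x \<in> verts G \<Longrightarrow> \<exists>n. capture_within G n 0 C0 x"
  shows "\<exists>S. winning_strategy G k S"
proof -
  define legal where "legal t = list_all2 (\<lambda>u v. (u, v) \<in> snapshot_at G t)" for t
  \<comment> \<open>Once some bound works, the least one is positive because
    \<open>capture_within\<close> fails at 0, so the subtraction is a true descent.\<close>
  define good where "good t C x C' \<longleftrightarrow> legal t C C' \<and>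
    (x \<in> set C' \<or> (\<forall>y. (x, y) \<in> snapshot_at G t \<longrightarrow>
       capture_within G ((LEAST n. capture_within G n t C x) - 1) (Suc t) C' y))" for t C x C'
  \<comment> \<open>Waiting is the default: \<open>cop_strategy\<close> demands legal moves along
    every walk, even after a capture, when a good move may be missing.\<close>
  define T where "T t C x = (if \<exists>C'. good t C x C' then SOME C'. good t C x C' else C)"
    for t C x
  \<comment> \<open>A strategy sees only the robber's history, so the fold recomputes the round and
    the placement of the cops from it.\<close>
  define S where "S h = snd (foldl (\<lambda>(t, C) x. (Suc t, T t C x)) (0, C0) h)" for h
  have fst_eq: "fst (foldl (\<lambda>(t, C) x. (Suc t, T t C x)) (0, C0) h) = length h" for h
    by (induction h rule: rev_induct) (auto split: prod.splits)
  have S_Nil: "S [] = C0"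
    by (simp add: S_def)
  have S_snoc: "S (h @ [x]) = T (length h) (S h) x" for h x
    by (simp add: S_def split_beta flip: fst_eq)
  have T_good: "good t C x (T t C x)" if "capture_within G n t C x" for n t C x
  proof -
    define m where "m = (LEAST n. capture_within G n t C x)"
    have m: "capture_within G m t C x"
      unfolding m_def using that by (rule LeastI)
    then obtain m' where "m = Suc m'"
      by (cases m) auto
    with m have "\<exists>C'. good t C x C'"
      unfolding good_def m_def[symmetric] legal_def by auto
    then show ?thesis
      unfolding T_def by (auto intro: someI_ex)
  qed
  have T_legal: "legal t C (T t C x)" if "set C \<subseteq> verts G" for t C x
  proof (cases "\<exists>C'. good t C x C'")
    case True
    then have "good t C x (T t C x)"
      unfolding T_def by (auto intro: someI_ex)
    then show ?thesis by (simp add: good_def)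
  next
    case False
    then show ?thesis
      using list_all2_snapshot_at_refl[OF G that] by (simp add: T_def legal_def)
  qed
  have S_verts: "set (S h) \<subseteq> verts G" for h
  proof (induction h rule: rev_induct)
    case (snoc x h)
    then show ?case
      using T_legal list_all2_snapshot_at_verts[OF G] unfolding S_snoc legal_def by blast
  qed (simp add: S_Nil C0)
  have "cop_strategy G k S"
    unfolding cop_strategy_def using T_legal[OF S_verts]
    by (auto simp: S_Nil C0(1) S_snoc legal_def intro: subsetD[OF C0(2)])
  moreover have "\<exists>t. r t \<in> set (S (map r [0..<Suc t]))" if r: "robber_walk G r" for r
  proof -
    have *: "\<exists>t. r t \<in> set (S (map r [0..<Suc t]))"
      if "capture_within G n t (S (map r [0..<t])) (r t)" for n t
      using that
    proof (induction n arbitrary: t rule: less_induct)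
      case (less n)
      let ?C = "S (map r [0..<t])"
      define m where "m = (LEAST n. capture_within G n t ?C (r t))"
      have "m \<le> n"
        unfolding m_def using less.prems by (rule Least_le)
      moreover have "m \<noteq> 0"
        using LeastI[of "\<lambda>n. capture_within G n t ?C (r t)", OF less.prems]
        unfolding m_def by (metis capture_within.simps(1))
      ultimately have m: "m - 1 < n" by linarith
      have next_C: "S (map r [0..<Suc t]) = T t ?C (r t)"
        by (simp add: S_snoc)
      show ?case
      proof (cases "r t \<in> set (S (map r [0..<Suc t]))")
        case False
        then have "capture_within G (m - 1) (Suc t) (S (map r [0..<Suc t])) (r (Suc t))"
          using T_good[OF less.prems] r unfolding good_def next_C m_def robber_walk_def by blast
        then show ?thesis
          by (rule less.IH[OF m])
      qed blast
    qed
    have "r 0 \<in> verts G"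
      using r by (simp add: robber_walk_def)
    then show ?thesis
      using win *[of _ 0] S_Nil by fastforce
  qed
  ultimately show ?thesis
    unfolding winning_strategy_def by blast
qed

text \<open>\<open>I t C x\<close> describes the position before the cops move in round
  \<open>t\<close>. Against a fixed strategy the robber answers each move so as to restore
  \<open>I\<close>, which rules out capture by the next one.\<close>

lemma not_winning_strategy_if_invariant:
  assumes G: "is_periodic_graph G"
    and init: "\<And>C. length C = k \<Longrightarrow> set C \<subseteq> verts G \<Longrightarrow> \<exists>x\<in>verts G. I 0 C x"
    and step: "\<And>t C x C'. I t C x \<Longrightarrow>
      list_all2 (\<lambda>u v. (u, v) \<in> snapshot_at G t) C C' \<Longrightarrow>
      x \<notin> set C' \<and> (\<exists>y. (x, y) \<in> snapshot_at G t \<and> I (Suc t) C' y)"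
  shows "\<not> winning_strategy G k S"
proof
  assume S: "winning_strategy G k S"
  then have "length (S []) = k" "set (S []) \<subseteq> verts G"
    by (auto simp: winning_strategy_def cop_strategy_def)
  then obtain x0 where x0: "x0 \<in> verts G" "I 0 (S []) x0"
    using init by blast
  define nxt where "nxt t C x = (SOME y. (x, y) \<in> snapshot_at G t \<and> I (Suc t) C y)" for t C x
  \<comment> \<open>Each reply depends on all earlier positions through \<open>S\<close>, so the
    recursion builds the whole history; \<open>H t\<close> has \<open>t + 1\<close> entries.\<close>
  define H where "H = rec_nat [x0] (\<lambda>t h. h @ [nxt t (S h) (last h)])"
  define r where "r t = last (H t)" for t
  have H0: "H 0 = [x0]" and HS: "\<And>t. H (Suc t) = H t @ [nxt t (S (H t)) (last (H t))]"
    by (simp_all add: H_def)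
  have H: "H t = map r [0..<Suc t]" for t
    by (induction t) (simp_all add: H0 HS r_def)
  have r0: "r 0 = x0"
    by (simp add: r_def H0)
  have rS: "r (Suc t) = nxt t (S (map r [0..<Suc t])) (r t)" for t
    unfolding H[symmetric] by (simp add: r_def HS)
  have inv: "I t (S (map r [0..<t])) (r t) \<and> (\<forall>s<t. (r s, r (Suc s)) \<in> snapshot_at G s)" for t
  proof (induction t)
    case 0
    then show ?case using x0 by (simp add: r0)
  next
    case (Suc t)
    \<comment> \<open>The cops' moves are known to be legal only along full walks, and
      \<open>r\<close> is so far known to be legal only before round \<open>t\<close>. Freezing the
      robber from then on gives a walk with the same history.\<close>
    define r' where "r' s = r (min s t)" for s
    have rt: "r t \<in> verts G"
      using Suc snapshot_at_vertsD(2)[OF G] x0(1) r0 by (cases t) auto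
    have "robber_walk G r'"
      unfolding robber_walk_def
    proof (intro conjI allI)
      show "r' 0 \<in> verts G"
        by (simp add: r'_def r0 x0)
      show "(r' s, r' (Suc s)) \<in> snapshot_at G s" for s
      proof (cases "s < t")
        case True
        then show ?thesis using Suc by (simp add: r'_def min_def)
      next
        case False
        then show ?thesis
          using snapshot_at_refl[OF G rt] by (simp add: r'_def min_def)
      qed
    qed
    moreover have "map r' [0..<t] = map r [0..<t]" "map r' [0..<Suc t] = map r [0..<Suc t]"
      by (auto simp: r'_def)
    ultimately have "list_all2 (\<lambda>u v. (u, v) \<in> snapshot_at G t)
        (S (map r [0..<t])) (S (map r [0..<Suc t]))"
      using S unfolding winning_strategy_def cop_strategy_def by metis
    then have "\<exists>y. (r t, y) \<in> snapshot_at G t \<and> I (Suc t) (S (map r [0..<Suc t])) y"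
      using step Suc by blast
    then have "(r t, r (Suc t)) \<in> snapshot_at G t \<and>
        I (Suc t) (S (map r [0..<Suc t])) (r (Suc t))"
      unfolding rS nxt_def by (rule someI_ex)
    then show ?case
      using Suc by (auto simp: less_Suc_eq)
  qed
  then have walk: "robber_walk G r"
    using x0 r0 by (auto simp: robber_walk_def)
  then obtain t where "r t \<in> set (S (map r [0..<Suc t]))"
    using S by (auto simp: winning_strategy_def)
  moreover have "list_all2 (\<lambda>u v. (u, v) \<in> snapshot_at G t)
      (S (map r [0..<t])) (S (map r [0..<Suc t]))"
    using S walk unfolding winning_strategy_def cop_strategy_def by blast
  ultimately show False
    using step inv by blast
qed

text \<open>The extra cop waits on a fixed vertex throughout.\<close>

lemma winning_strategy_Suc:
  assumes G: "is_periodic_graph G" and S: "winning_strategy G k S"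
  shows "\<exists>S. winning_strategy G (Suc k) S"
proof -
  obtain v where v: "v \<in> verts G"
    using G by (auto simp: is_periodic_graph_def)
  have "winning_strategy G (Suc k) (\<lambda>h. v # S h)"
    using S v snapshot_at_refl[OF G v]
    by (auto simp: winning_strategy_def cop_strategy_def simp del: upt_Suc)
  then show ?thesis by blast
qed

lemma winning_strategy_mono:
  assumes "is_periodic_graph G" "winning_strategy G k S" "k \<le> l"
  shows "\<exists>S. winning_strategy G l S"
  using assms(3)
proof (induction rule: dec_induct)
  case base
  then show ?case using assms(2) by blast
next
  case (step n)
  then show ?case using winning_strategy_Suc[OF assms(1)] by blast
qed

section \<open>Relabelling the vertices\<close>

text \<open>Needed because the theorem's witness has vertices of type \<open>nat\<close>, whereas
  those of the cube are sets and the lower bound concerns an arbitrary type.\<close>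

definition relabel :: "('v \<Rightarrow> 'w) \<Rightarrow> 'v periodic_graph \<Rightarrow> 'w periodic_graph" where
  "relabel f G =
     \<lparr>verts = f ` verts G, snapshots = map (\<lambda>E. map_prod f f ` E) (snapshots G)\<rparr>"

lemma snapshot_at_relabel:
  "is_periodic_graph G \<Longrightarrow> snapshot_at (relabel f G) t = map_prod f f ` snapshot_at G t"
  unfolding is_periodic_graph_def snapshot_at_def relabel_def
  by (simp, subst nth_map) (auto intro!: mod_less_divisor)

lemma footprint_relabel: "footprint (relabel f G) = map_prod f f ` footprint G"
  by (auto simp: footprint_def relabel_def)

lemma is_periodic_graph_relabel:
  assumes G: "is_periodic_graph G"
  shows "is_periodic_graph (relabel f G)"
proof -
  have "reflexive_graph_on (f ` verts G) (map_prod f f ` E)"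
    if "reflexive_graph_on (verts G) E" for E
    using that unfolding reflexive_graph_on_def refl_on_def sym_def by fastforce
  moreover have "(f u, f v) \<in> (footprint (relabel f G))\<^sup>*" if "(u, v) \<in> (footprint G)\<^sup>*" for u v
    using that
  proof induction
    case (step y z)
    then have "(f y, f z) \<in> footprint (relabel f G)"
      by (force simp: footprint_relabel)
    with step.IH show ?case by (rule rtrancl_into_rtrancl)
  qed simp
  ultimately show ?thesis
    using G by (auto simp: is_periodic_graph_def relabel_def)
qed

text \<open>The cops pull the robber's history back along an inverse \<open>g\<close> of
  \<open>f\<close>, consult \<open>S\<close> on \<open>G\<close> and push its answer
  forward.\<close>

lemma winning_strategy_relabel:
  assumes G: "is_periodic_graph G" and inj: "inj_on f (verts G)"
    and S: "winning_strategy G k S"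
  shows "\<exists>S'. winning_strategy (relabel f G) k S'"
proof -
  define g where "g = inv_into (verts G) f"
  have gf: "g (f v) = v" if "v \<in> verts G" for v
    using that inj by (simp add: g_def)
  have walk: "robber_walk G (g \<circ> r)" if "robber_walk (relabel f G) r" for r
    unfolding robber_walk_def
  proof (intro conjI allI)
    show "(g \<circ> r) 0 \<in> verts G"
      using that by (auto simp: robber_walk_def relabel_def gf)
    fix t
    have "(r t, r (Suc t)) \<in> map_prod f f ` snapshot_at G t"
      using that by (simp add: robber_walk_def snapshot_at_relabel[OF G])
    then obtain u v where "(u, v) \<in> snapshot_at G t" "r t = f u" "r (Suc t) = f v"
      by auto
    then show "((g \<circ> r) t, (g \<circ> r) (Suc t)) \<in> snapshot_at G t"
      using snapshot_at_vertsD[OF G] by (simp add: gf)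
  qed
  have fg: "f (g (r t)) = r t" if "robber_walk (relabel f G) r" for r t
  proof -
    have "r t \<in> verts (relabel f G)"
      by (rule robber_walk_verts[OF is_periodic_graph_relabel[OF G] that])
    then show ?thesis by (auto simp: relabel_def gf)
  qed
  define S' where "S' h = map f (S (map g h))" for h
  have S'_map: "S' (map r [0..<t]) = map f (S (map (g \<circ> r) [0..<t]))" for r t
    by (simp add: S'_def)
  have "cop_strategy (relabel f G) k S'"
    unfolding cop_strategy_def
  proof (intro conjI allI impI)
    show "length (S' []) = k" "set (S' []) \<subseteq> verts (relabel f G)"
      using S by (auto simp: S'_def winning_strategy_def cop_strategy_def relabel_def)
    fix r t
    assume "robber_walk (relabel f G) r"
    then have "list_all2 (\<lambda>u v. (u, v) \<in> snapshot_at G t)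
        (S (map (g \<circ> r) [0..<t])) (S (map (g \<circ> r) [0..<Suc t]))"
      using S walk unfolding winning_strategy_def cop_strategy_def by blast
    then show "list_all2 (\<lambda>u v. (u, v) \<in> snapshot_at (relabel f G) t)
        (S' (map r [0..<t])) (S' (map r [0..<Suc t]))"
      unfolding S'_map list.rel_map snapshot_at_relabel[OF G]
      by (rule list_all2_mono) (force intro: image_eqI)
  qed
  moreover have "\<exists>t. r t \<in> set (S' (map r [0..<Suc t]))"
    if r: "robber_walk (relabel f G) r" for r
  proof -
    obtain t where "(g \<circ> r) t \<in> set (S (map (g \<circ> r) [0..<Suc t]))"
      using S walk[OF r] unfolding winning_strategy_def by blast
    then have "f ((g \<circ> r) t) \<in> set (S' (map r [0..<Suc t]))"
      unfolding S'_map by simp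
    then show ?thesis
      using fg[OF r] by auto
  qed
  ultimately show ?thesis
    unfolding winning_strategy_def by blast
qed

lemma relabel_inverse:
  assumes G: "is_periodic_graph G" and gf: "\<And>v. v \<in> verts G \<Longrightarrow> g (f v) = v"
  shows "relabel g (relabel f G) = G"
proof -
  have "map_prod g g ` map_prod f f ` E = E" if "E \<in> set (snapshots G)" for E
  proof -
    have "E \<subseteq> verts G \<times> verts G"
      using G that by (auto simp: is_periodic_graph_def reflexive_graph_on_def)
    then have "(map_prod g g \<circ> map_prod f f) ` E = id ` E"
      by (intro image_cong) (auto simp: gf)
    then show ?thesis by (simp add: image_comp)
  qed
  moreover have "g ` f ` verts G = verts G"
    using gf by force
  ultimately show ?thesis
    by (simp add: relabel_def map_idI)
qed

text \<open>By \<open>relabel_inverse\<close> strategies can also be transported from the relabelled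
  graph back to \<open>G\<close>.\<close>

lemma cop_number_relabel:
  assumes G: "is_periodic_graph G" and inj: "inj_on f (verts G)"
  shows "cop_number (relabel f G) = cop_number G"
proof -
  have "(\<exists>S. winning_strategy (relabel f G) k S) \<longleftrightarrow> (\<exists>S. winning_strategy G k S)" for k
  proof
    assume "\<exists>S. winning_strategy (relabel f G) k S"
    moreover have "inj_on (inv_into (verts G) f) (verts (relabel f G))"
      by (simp add: relabel_def inj_on_inv_into)
    moreover have "relabel (inv_into (verts G) f) (relabel f G) = G"
      by (rule relabel_inverse[OF G]) (simp add: inj)
    ultimately show "\<exists>S. winning_strategy G k S"
      using winning_strategy_relabel[OF is_periodic_graph_relabel[OF G]] by metis
  qed (use winning_strategy_relabel[OF G inj] in blast)
  then show ?thesis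
    by (simp add: cop_number_def)
qed

section \<open>Two cops win on at most four vertices\<close>

text \<open>Each robber reply has its own bound; as there are finitely many, monotonicity lets the
  maximum serve for all.\<close>

lemma ex_capture_within_if_next:
  assumes G: "is_periodic_graph G"
    and move: "list_all2 (\<lambda>u v. (u, v) \<in> snapshot_at G t) C C'"
    and captured: "\<And>y. (x, y) \<in> snapshot_at G t \<Longrightarrow> \<exists>n. capture_within G n (Suc t) C' y"
  shows "\<exists>n. capture_within G n t C x"
proof -
  obtain N where N: "\<And>y. (x, y) \<in> snapshot_at G t \<Longrightarrow> capture_within G (N y) (Suc t) C' y"
    using captured by metis
  define Y where "Y = {y. (x, y) \<in> snapshot_at G t}"
  have "Y \<subseteq> verts G"
    using snapshot_at_vertsD(2)[OF G] by (auto simp: Y_def)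
  then have "finite Y"
    using G by (auto simp: is_periodic_graph_def intro: finite_subset)
  then have "capture_within G (Max (N ` Y)) (Suc t) C' y" if "(x, y) \<in> snapshot_at G t" for y
    using that by (intro capture_within_mono[OF N[OF that]] Max_ge) (auto simp: Y_def)
  then have "capture_within G (Suc (Max (N ` Y))) t C x"
    using move by auto
  then show ?thesis by blast
qed

lemma capture_within_if_adjacent:
  assumes G: "is_periodic_graph G" and C: "set C \<subseteq> verts G" "z \<in> set C"
    and "(z, x) \<in> snapshot_at G t"
  shows "capture_within G (Suc 0) t C x"
proof -
  obtain i where i: "i < length C" "C ! i = z"
    using C(2) by (auto simp: in_set_conv_nth)
  have "list_all2 (\<lambda>u v. (u, v) \<in> snapshot_at G t) C (C[i := x])"
    using assms i by (auto simp: list_all2_conv_all_nth nth_list_update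
        intro!: snapshot_at_refl intro: subsetD[OF C(1)])
  moreover have "x \<in> set (C[i := x])"
    using i(1) by (rule set_update_memI)
  ultimately show ?thesis
    by auto
qed

text \<open>Here connectedness enters: a path from \<open>y\<close> to \<open>z\<close> contains an
  edge leaving \<open>y\<close>, which belongs to some snapshot.\<close>

lemma footprint_neighbour:
  assumes G: "is_periodic_graph G" and y: "y \<in> verts G" and z: "z \<in> verts G" "z \<noteq> y"
  shows "\<exists>w t. w \<noteq> y \<and> (y, w) \<in> snapshot_at G t"
proof -
  have "(y, z) \<in> (footprint G)\<^sup>*"
    using G y z by (auto simp: is_periodic_graph_def)
  then have "\<exists>w. w \<noteq> y \<and> (y, w) \<in> footprint G"
    using z(2)
  proof induction
    case (step u v)
    then show ?case by (cases "u = y") auto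
  qed simp
  then obtain w i where "w \<noteq> y" "i < length (snapshots G)" "(y, w) \<in> snapshots G ! i"
    by (auto simp: footprint_def in_set_conv_nth)
  then have "w \<noteq> y \<and> (y, w) \<in> snapshot_at G i"
    by (simp add: snapshot_at_def)
  then show ?thesis by blast
qed

lemma ex_capture_within_cover:
  assumes G: "is_periodic_graph G" and y: "y \<in> verts G"
    and C: "set C1 \<subseteq> verts G" "set C2 \<subseteq> verts G" "C1 \<noteq> []"
    and cover: "verts G \<subseteq> insert y (set C1 \<union> set C2)"
  shows "(\<exists>n. capture_within G n 0 C1 y) \<or> (\<exists>n. capture_within G n 0 C2 y)"
proof (rule ccontr)
  assume safe: "\<not> ?thesis"
  \<comment> \<open>A neighbour other than \<open>y\<close> would lie in one of the placements, from
    where a cop captures at once.\<close>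
  have isolated: "w = y"
    if "\<nexists>n. capture_within G n t C1 y" "\<nexists>n. capture_within G n t C2 y"
      "(y, w) \<in> snapshot_at G t" for t w
  proof (rule ccontr)
    assume "w \<noteq> y"
    with cover snapshot_at_vertsD(2)[OF G that(3)] have "w \<in> set C1 \<or> w \<in> set C2"
      by blast
    with capture_within_if_adjacent[OF G _ _ snapshot_at_sym[OF G that(3)]] C that(1,2)
    show False by blast
  qed
  \<comment> \<open>In both games the cops just wait. The isolated robber must stay on
    \<open>y\<close>, so a win from round \<open>Suc t\<close> would give one from round
    \<open>t\<close>.\<close>
  have safe_always: "(\<nexists>n. capture_within G n t C1 y) \<and> (\<nexists>n. capture_within G n t C2 y)" for t
  proof (induction t)
    case 0
    then show ?case using safe by blast
  next
    case (Suc t)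
    then have "w = y" if "(y, w) \<in> snapshot_at G t" for w
      using isolated that by blast
    then show ?case
      using Suc ex_capture_within_if_next[OF G list_all2_snapshot_at_refl[OF G]] C(1,2) by metis
  qed
  \<comment> \<open>A cop on \<open>y\<close> would capture by staying, so \<open>C1\<close>
    supplies a vertex other than \<open>y\<close>, as \<open>footprint_neighbour\<close>
    requires.\<close>
  have "y \<notin> set C1"
    using capture_within_if_adjacent[OF G C(1) _ snapshot_at_refl[OF G y]] safe by blast
  then have "hd C1 \<in> verts G" "hd C1 \<noteq> y"
    using C hd_in_set[OF C(3)] by auto
  from footprint_neighbour[OF G y this] safe_always isolated show False
    by blast
qed

lemma ex_four_enumeration:
  assumes "finite A" "A \<noteq> {}" "card A \<le> 4"
  shows "\<exists>a b c d. A = {a, b, c, d}"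
proof -
  obtain xs where xs: "set xs = A" "length xs = card A"
    using finite_distinct_list[OF assms(1)] distinct_card by metis
  obtain a where a: "a \<in> A"
    using assms(2) by blast
  \<comment> \<open>Indices past the end of the list repeat \<open>a\<close>, which covers smaller
    sets too.\<close>
  define f where "f i = (if i < length xs then xs ! i else a)" for i
  have "A = f ` {..<4}"
    using xs assms(3) a by (force simp: f_def in_set_conv_nth image_iff)
  also have "\<dots> = {f 0, f 1, f 2, f 3}"
    by (auto simp: numeral_eq_Suc lessThan_Suc)
  finally show ?thesis by blast
qed

lemma two_cops_win_if_card_le_4:
  assumes G: "is_periodic_graph G" and card: "card (verts G) \<le> 4"
  shows "\<exists>S. winning_strategy G 2 S"
proof (rule ccontr)
  assume lose: "\<not> ?thesis"
  obtain a b c d where V: "verts G = {a, b, c, d}"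
    using ex_four_enumeration G card by (metis is_periodic_graph_def)
  define safe where "safe C x \<longleftrightarrow> (\<nexists>n. capture_within G n 0 C x)" for C x
  \<comment> \<open>A start on a cop's vertex is never safe, because that cop captures by
    staying.\<close>
  have two: "safe [u, v] w \<or> safe [u, v] w'" if "verts G = {u, v, w, w'}" for u v w w'
  proof -
    have sub: "set [u, v] \<subseteq> verts G"
      using that by simp
    have "\<exists>x\<in>verts G. safe [u, v] x"
    proof (rule ccontr)
      assume "\<not> ?thesis"
      then have "\<exists>S. winning_strategy G 2 S"
        by (intro winning_strategy_if_capture_within[OF G _ sub]) (auto simp: safe_def)
      with lose show False ..
    qed
    then obtain x where x: "x \<in> verts G" "safe [u, v] x" ..
    have "x \<notin> set [u, v]"
      using capture_within_if_adjacent[OF G sub _ snapshot_at_refl[OF G x(1)]] x(2)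
      unfolding safe_def by blast
    with x that show ?thesis by auto
  qed
  have one: "\<not> safe [u, v] y \<or> \<not> safe [u', v'] y"
    if "verts G = {y, u, v, u', v'}" for y u v u' v'
  proof -
    have "y \<in> verts G" "set [u, v] \<subseteq> verts G" "set [u', v'] \<subseteq> verts G" "[u, v] \<noteq> []"
      "verts G \<subseteq> insert y (set [u, v] \<union> set [u', v'])"
      using that by simp_all
    from ex_capture_within_cover[OF G this] show ?thesis
      unfolding safe_def by blast
  qed
  \<comment> \<open>Six pairs each have a safe vertex, and no vertex is safe against two of the
    three pairs that omit its name, since these cover the rest. Six into four is then a
    propositional contradiction.\<close>
  have "safe [a, b] c \<or> safe [a, b] d" "safe [a, c] b \<or> safe [a, c] d"
    "safe [a, d] b \<or> safe [a, d] c" "safe [b, c] a \<or> safe [b, c] d"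
    "safe [b, d] a \<or> safe [b, d] c" "safe [c, d] a \<or> safe [c, d] b"
    by (rule two; use V in auto)+
  moreover have
    "\<not> safe [b, c] a \<or> \<not> safe [b, d] a" "\<not> safe [b, c] a \<or> \<not> safe [c, d] a"
    "\<not> safe [b, d] a \<or> \<not> safe [c, d] a"
    "\<not> safe [a, c] b \<or> \<not> safe [a, d] b" "\<not> safe [a, c] b \<or> \<not> safe [c, d] b"
    "\<not> safe [a, d] b \<or> \<not> safe [c, d] b"
    "\<not> safe [a, b] c \<or> \<not> safe [a, d] c" "\<not> safe [a, b] c \<or> \<not> safe [b, d] c"
    "\<not> safe [a, d] c \<or> \<not> safe [b, d] c"
    "\<not> safe [a, b] d \<or> \<not> safe [a, c] d" "\<not> safe [a, b] d \<or> \<not> safe [b, c] d"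
    "\<not> safe [a, c] d \<or> \<not> safe [b, c] d"
    by (rule one; use V in auto)+
  ultimately show False
    by argo
qed

section \<open>The cube with one coordinate per round\<close>

text \<open>Sets stand for 0-1 vectors of length 3. For \<open>i < 3\<close> this is the perfect
  matching of the cube in direction \<open>i\<close>, with all loops.\<close>

definition cube_edges :: "nat \<Rightarrow> nat set rel" where
  "cube_edges i = {(u, v). u \<subseteq> {..<3} \<and> v \<subseteq> {..<3} \<and> u - {i} = v - {i}}"

definition cube :: "nat set periodic_graph" where
  "cube = \<lparr>verts = Pow {..<3}, snapshots = map cube_edges [0..<3]\<rparr>"

definition agree :: "nat \<Rightarrow> nat set \<Rightarrow> nat set \<Rightarrow> bool" where
  "agree i u v \<longleftrightarrow> (i \<in> u \<longleftrightarrow> i \<in> v)"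

lemma verts_cube: "verts cube = Pow {..<3}"
  by (simp add: cube_def)

lemma snapshot_at_cube: "snapshot_at cube t = cube_edges (t mod 3)"
  by (simp add: snapshot_at_def cube_def)

lemma is_periodic_graph_cube: "is_periodic_graph cube"
proof -
  have "reflexive_graph_on (Pow {..<3}) (cube_edges i)" for i
    by (auto simp: reflexive_graph_on_def cube_edges_def refl_on_def sym_def)
  moreover have "(u, v) \<in> (footprint cube)\<^sup>*" if "u \<subseteq> {..<3}" "v \<subseteq> {..<3}" for u v
  proof -
    have fp: "(u, v) \<in> footprint cube" if "(u, v) \<in> cube_edges i" "i < 3" for u v i
      using that by (auto simp: footprint_def cube_def)
    \<comment> \<open>Coordinates below \<open>i\<close> already come from \<open>v\<close>, the
      others still from \<open>u\<close>: a path changing at most one coordinate per step.\<close>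
    define w where "w i = (v \<inter> {..<i}) \<union> (u - {..<i})" for i :: nat
    have "(w i, w (Suc i)) \<in> cube_edges i" for i
      using that by (auto simp: w_def cube_edges_def less_Suc_eq)
    then have step: "(w i, w (Suc i)) \<in> footprint cube" if "i < 3" for i
      using fp that by blast
    have "(w 0, w i) \<in> (footprint cube)\<^sup>*" if "i \<le> 3" for i
      using that by (induction i) (auto elim: rtrancl_into_rtrancl intro!: step)
    then have "(w 0, w 3) \<in> (footprint cube)\<^sup>*"
      by simp
    moreover have "w 0 = u" "w 3 = v"
      using that by (auto simp: w_def)
    ultimately show ?thesis by simp
  qed
  ultimately show ?thesis
    by (auto simp: is_periodic_graph_def cube_def)
qed

text \<open>Staying and flipping coordinate \<open>i\<close> realise the two truth values. Both the
  cops and the robber move by this.\<close>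

lemma cube_edges_choose:
  assumes "u \<subseteq> {..<3}" "i < 3"
  shows "\<exists>v. (u, v) \<in> cube_edges i \<and> (agree i v x \<longleftrightarrow> b)"
proof (cases "agree i u x \<longleftrightarrow> b")
  case True
  then show ?thesis using assms by (auto simp: cube_edges_def)
next
  case False
  define v where "v = (if i \<in> u then u - {i} else insert i u)"
  have "(u, v) \<in> cube_edges i" "agree i v x \<longleftrightarrow> b"
    using assms False by (auto simp: cube_edges_def v_def agree_def)
  then show ?thesis by blast
qed

lemma cube_edges_agree_iff:
  "(u, u') \<in> cube_edges i \<Longrightarrow> (v, v') \<in> cube_edges i \<Longrightarrow> k \<noteq> i \<Longrightarrow>
     agree k u' v' \<longleftrightarrow> agree k u v"
  unfolding cube_edges_def agree_def by auto

text \<open>From here on coordinates are named relative to the round: the one being played, the next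
  and the third.\<close>

lemma lessThan_3_mod: "{..<3} = {t mod 3, Suc t mod 3, Suc (Suc t) mod 3}" for t :: nat
proof -
  have "t mod 3 = 0 \<or> t mod 3 = 1 \<or> t mod 3 = 2"
    by linarith
  then show ?thesis
    by (elim disjE) (auto simp: mod_Suc)
qed

lemma mod3_Suc_neq: "Suc t mod 3 \<noteq> t mod 3" "Suc (Suc t) mod 3 \<noteq> t mod 3"
    "Suc (Suc t) mod 3 \<noteq> Suc t mod 3"
  by (auto simp: mod_Suc)

text \<open>On passing to round \<open>Suc t\<close>, the coordinate just played becomes the third
  one in this naming.\<close>

lemma mod3_Suc_Suc_Suc: "Suc (Suc (Suc t)) mod 3 = t mod 3"
  using mod_add_self2[of t 3] by (simp only: numeral_3_eq_3 add_Suc_right add_0_right)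

lemma cube_edges_iff_agree:
  assumes "u \<subseteq> {..<3}" "v \<subseteq> {..<3}"
  shows "(u, v) \<in> cube_edges (t mod 3) \<longleftrightarrow> agree (Suc t mod 3) u v \<and> agree (Suc (Suc t) mod 3) u v"
proof -
  have "u - {t mod 3} = v - {t mod 3} \<longleftrightarrow>
      (\<forall>i \<in> {t mod 3, Suc t mod 3, Suc (Suc t) mod 3}. i \<noteq> t mod 3 \<longrightarrow> (i \<in> u \<longleftrightarrow> i \<in> v))"
    using assms unfolding lessThan_3_mod[of t, symmetric] by blast
  then show ?thesis
    using assms mod3_Suc_neq[of t] by (simp add: cube_edges_def agree_def)
qed

section \<open>Capture by three cops on the cube\<close>

context
  fixes c1 c2 c3 x :: "nat set" and t :: nat
  assumes subsets: "c1 \<subseteq> {..<3}" "c2 \<subseteq> {..<3}" "c3 \<subseteq> {..<3}" "x \<subseteq> {..<3}"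
begin

text \<open>The bits \<open>b1\<close>, \<open>b2\<close>, \<open>b3\<close> are a plan: which cops
  are to match the robber's old vertex \<open>x\<close> in the current coordinate. It remains to
  handle every reply \<open>y\<close>.\<close>

lemma cube_capture_step:
  assumes "\<And>c1' c2' c3' y.
      (c1, c1') \<in> cube_edges (t mod 3) \<Longrightarrow> (c2, c2') \<in> cube_edges (t mod 3) \<Longrightarrow>
      (c3, c3') \<in> cube_edges (t mod 3) \<Longrightarrow> (x, y) \<in> cube_edges (t mod 3) \<Longrightarrow>
      agree (t mod 3) c1' x = b1 \<Longrightarrow> agree (t mod 3) c2' x = b2 \<Longrightarrow>
      agree (t mod 3) c3' x = b3 \<Longrightarrow> capture_within cube n (Suc t) [c1', c2', c3'] y"
  shows "capture_within cube (Suc n) t [c1, c2, c3] x"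
proof -
  have t: "t mod 3 < 3"
    by simp
  obtain c1' where c1': "(c1, c1') \<in> cube_edges (t mod 3)" "agree (t mod 3) c1' x = b1"
    using cube_edges_choose[OF subsets(1) t, of x b1] by (elim exE conjE)
  obtain c2' where c2': "(c2, c2') \<in> cube_edges (t mod 3)" "agree (t mod 3) c2' x = b2"
    using cube_edges_choose[OF subsets(2) t, of x b2] by (elim exE conjE)
  obtain c3' where c3': "(c3, c3') \<in> cube_edges (t mod 3)" "agree (t mod 3) c3' x = b3"
    using cube_edges_choose[OF subsets(3) t, of x b3] by (elim exE conjE)
  have "list_all2 (\<lambda>u v. (u, v) \<in> snapshot_at cube t) [c1, c2, c3] [c1', c2', c3']"
    using c1' c2' c3' by (simp add: snapshot_at_cube)
  moreover have "capture_within cube n (Suc t) [c1', c2', c3'] y"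
    if "(x, y) \<in> snapshot_at cube t" for y
    using assms[OF c1'(1) c2'(1) c3'(1) _ c1'(2) c2'(2) c3'(2)] that unfolding snapshot_at_cube by blast
  ultimately show ?thesis
    unfolding capture_within.simps(2) by blast
qed

lemma cube_capture_within_1:
  assumes "c \<in> {c1, c2, c3}" "agree (Suc t mod 3) c x" "agree (Suc (Suc t) mod 3) c x"
  shows "capture_within cube (Suc 0) t [c1, c2, c3] x"
proof -
  have "c \<subseteq> {..<3}"
    using assms(1) subsets by blast
  then have "(c, x) \<in> snapshot_at cube t"
    using assms(2,3) subsets(4) by (simp only: cube_edges_iff_agree snapshot_at_cube)
  moreover have "set [c1, c2, c3] \<subseteq> verts cube" "c \<in> set [c1, c2, c3]"
    using assms(1) subsets unfolding verts_cube by simp_all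
  ultimately show ?thesis
    using capture_within_if_adjacent[OF is_periodic_graph_cube] by blast
qed

end

lemma cube_edges_subset:
  "(u, v) \<in> cube_edges i \<Longrightarrow> u \<subseteq> {..<3} \<and> v \<subseteq> {..<3}"
  by (simp add: cube_edges_def)

text \<open>With \<open>x\<close> the old and \<open>y\<close> the new vertex of the robber: its
  move preserves the agreement in coordinate \<open>i\<close> for all cops or reverses it for
  all.\<close>

lemma agree_iff_agree_via: "agree i c y \<longleftrightarrow> (agree i c x \<longleftrightarrow> agree i x y)"
  by (auto simp: agree_def)

text \<open>One of the first two cops matches the current coordinate and the other does not, so
  after any reply exactly one of them does. It still agrees in the third coordinate and captures in
  the next round, which plays the remaining one.\<close>

lemma cube_capture_within_2:
  assumes subsets: "c1 \<subseteq> {..<3}" "c2 \<subseteq> {..<3}" "c3 \<subseteq> {..<3}" "x \<subseteq> {..<3}"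
    and "agree (Suc (Suc t) mod 3) c1 x" "agree (Suc (Suc t) mod 3) c2 x"
  shows "capture_within cube 2 t [c1, c2, c3] x"
  unfolding numeral_2_eq_2
proof (rule cube_capture_step[OF subsets, where ?b1.0 = True and ?b2.0 = False and ?b3.0 = True])
  fix c1' c2' c3' y
  assume moves: "(c1, c1') \<in> cube_edges (t mod 3)" "(c2, c2') \<in> cube_edges (t mod 3)"
      "(c3, c3') \<in> cube_edges (t mod 3)" "(x, y) \<in> cube_edges (t mod 3)"
    and *: "agree (t mod 3) c1' x = True" "agree (t mod 3) c2' x = False"
  let ?c = "if agree (t mod 3) x y then c1' else c2'"
  have "agree (Suc (Suc t) mod 3) c1' y" "agree (Suc (Suc t) mod 3) c2' y"
    using assms(5,6) moves cube_edges_agree_iff mod3_Suc_neq(2) by blast+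
  then show "capture_within cube (Suc 0) (Suc t) [c1', c2', c3'] y"
    using moves * agree_iff_agree_via[of "t mod 3" c1' y x] agree_iff_agree_via[of "t mod 3" c2' y x]
        agree_iff_agree_via[of "t mod 3" c3' y x]
    by (intro cube_capture_within_1[where c = ?c])
      (auto simp: mod3_Suc_Suc_Suc dest: cube_edges_subset)
qed

text \<open>The third cop deviates from the others. If the robber keeps the coordinate, two cops
  agree in the one just played and \<open>cube_capture_within_2\<close> applies; if it flips, the
  third cop agrees there besides its earlier agreement and captures next.\<close>

lemma cube_capture_within_3:
  assumes subsets: "c1 \<subseteq> {..<3}" "c2 \<subseteq> {..<3}" "c3 \<subseteq> {..<3}" "x \<subseteq> {..<3}"
    and "agree (Suc (Suc t) mod 3) c3 x"
  shows "capture_within cube 3 t [c1, c2, c3] x"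
  unfolding numeral_3_eq_3 numeral_2_eq_2[symmetric]
proof (rule cube_capture_step[OF subsets, where ?b1.0 = True and ?b2.0 = True and ?b3.0 = False])
  fix c1' c2' c3' y
  assume moves: "(c1, c1') \<in> cube_edges (t mod 3)" "(c2, c2') \<in> cube_edges (t mod 3)"
      "(c3, c3') \<in> cube_edges (t mod 3)" "(x, y) \<in> cube_edges (t mod 3)"
    and *: "agree (t mod 3) c1' x = True" "agree (t mod 3) c2' x = True"
      "agree (t mod 3) c3' x = False"
  have c3': "agree (Suc (Suc t) mod 3) c3' y"
    using assms(5) moves cube_edges_agree_iff mod3_Suc_neq(2) by blast
  show "capture_within cube 2 (Suc t) [c1', c2', c3'] y"
  proof (cases "agree (t mod 3) x y")
    case True
    then show ?thesis
      using moves * agree_iff_agree_via[of "t mod 3" c1' y x] agree_iff_agree_via[of "t mod 3" c2' y x]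
        agree_iff_agree_via[of "t mod 3" c3' y x]
      by (intro cube_capture_within_2) (auto simp: mod3_Suc_Suc_Suc dest: cube_edges_subset)
  next
    case False
    then have "capture_within cube (Suc 0) (Suc t) [c1', c2', c3'] y"
      using moves * c3' agree_iff_agree_via[of "t mod 3" c1' y x] agree_iff_agree_via[of "t mod 3" c2' y x]
        agree_iff_agree_via[of "t mod 3" c3' y x]
      by (intro cube_capture_within_1[where c = c3'])
        (auto simp: mod3_Suc_Suc_Suc dest: cube_edges_subset)
    then show ?thesis
      by (rule capture_within_mono) simp
  qed
qed

text \<open>The same plan without an earlier agreement: after a flip the third cop agrees in the
  coordinate just played, as \<open>cube_capture_within_3\<close> requires.\<close>

lemma cube_capture_within_4:
  assumes subsets: "c1 \<subseteq> {..<3}" "c2 \<subseteq> {..<3}" "c3 \<subseteq> {..<3}" "x \<subseteq> {..<3}"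
  shows "capture_within cube (Suc 3) t [c1, c2, c3] x"
proof (rule cube_capture_step[OF subsets, where ?b1.0 = True and ?b2.0 = True and ?b3.0 = False])
  fix c1' c2' c3' y
  assume moves: "(c1, c1') \<in> cube_edges (t mod 3)" "(c2, c2') \<in> cube_edges (t mod 3)"
      "(c3, c3') \<in> cube_edges (t mod 3)" "(x, y) \<in> cube_edges (t mod 3)"
    and *: "agree (t mod 3) c1' x = True" "agree (t mod 3) c2' x = True"
      "agree (t mod 3) c3' x = False"
  show "capture_within cube 3 (Suc t) [c1', c2', c3'] y"
  proof (cases "agree (t mod 3) x y")
    case True
    then have "capture_within cube 2 (Suc t) [c1', c2', c3'] y"
      using moves * agree_iff_agree_via[of "t mod 3" c1' y x] agree_iff_agree_via[of "t mod 3" c2' y x]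
        agree_iff_agree_via[of "t mod 3" c3' y x]
      by (intro cube_capture_within_2) (auto simp: mod3_Suc_Suc_Suc dest: cube_edges_subset)
    then show ?thesis
      by (rule capture_within_mono) simp
  next
    case False
    then show ?thesis
      using moves * agree_iff_agree_via[of "t mod 3" c1' y x] agree_iff_agree_via[of "t mod 3" c2' y x]
        agree_iff_agree_via[of "t mod 3" c3' y x]
      by (intro cube_capture_within_3) (auto simp: mod3_Suc_Suc_Suc dest: cube_edges_subset)
  qed
qed

lemma three_cops_win_cube: "\<exists>S. winning_strategy cube 3 S"
proof (rule winning_strategy_if_capture_within[OF is_periodic_graph_cube])
  show "length [{}, {}, {}] = 3" "set [{}, {}, {}] \<subseteq> verts cube"
    by (auto simp: cube_def)
  show "\<exists>n. capture_within cube n 0 [{}, {}, {}] x" if "x \<in> verts cube" for x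
  proof -
    have "x \<subseteq> {..<3}"
      using that by (simp add: cube_def)
    then show ?thesis
      using cube_capture_within_4[of "{}" "{}" "{}" x 0] by blast
  qed
qed

section \<open>Evasion of two cops on the cube\<close>

lemma two_cops_lose_cube: "\<not> winning_strategy cube 2 S"
proof (rule not_winning_strategy_if_invariant[OF is_periodic_graph_cube])
  \<comment> \<open>Besides non-adjacency, some cop must differ in the third coordinate: if both
    agreed there, they could split as in \<open>cube_capture_within_2\<close>.\<close>
  define I where "I t C x \<longleftrightarrow> (\<exists>c1 c2. C = [c1, c2] \<and>
      c1 \<subseteq> {..<3} \<and> c2 \<subseteq> {..<3} \<and> x \<subseteq> {..<3} \<and>
      (c1, x) \<notin> cube_edges (t mod 3) \<and> (c2, x) \<notin> cube_edges (t mod 3) \<and>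
      (\<not> agree (Suc (Suc t) mod 3) c1 x \<or> \<not> agree (Suc (Suc t) mod 3) c2 x))"
    for t C x
  show "\<exists>x\<in>verts cube. I 0 C x" if C: "length C = 2" "set C \<subseteq> verts cube" for C
  proof -
    obtain c1 c2 where c: "C = [c1, c2]" "c1 \<subseteq> {..<3}" "c2 \<subseteq> {..<3}"
      using C by (auto simp: numeral_2_eq_2 length_Suc_conv cube_def)
    \<comment> \<open>Round 0 does not play 1 and 2: \<open>c1\<close> is made to differ in 2, which
      also gives the last condition of \<open>I\<close>, and \<open>c2\<close> in 1.\<close>
    define x :: "nat set" where "x = {i. i = 1 \<and> 1 \<notin> c2 \<or> i = 2 \<and> 2 \<notin> c1}"
    have x: "x \<subseteq> {..<3}" "\<not> agree 2 c1 x" "\<not> agree 1 c2 x"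
      by (auto simp: x_def agree_def)
    then have "I 0 C x"
      using c cube_edges_iff_agree[of _ _ 0] by (auto simp: I_def numeral_2_eq_2)
    then show ?thesis
      using x by (auto simp: cube_def)
  qed
  fix t C x C'
  assume I: "I t C x" and move: "list_all2 (\<lambda>u v. (u, v) \<in> snapshot_at cube t) C C'"
  let ?i = "t mod 3" and ?j = "Suc t mod 3" and ?k = "Suc (Suc t) mod 3"
  obtain c1 c2 where c: "C = [c1, c2]" "c1 \<subseteq> {..<3}" "c2 \<subseteq> {..<3}" "x \<subseteq> {..<3}"
    "(c1, x) \<notin> cube_edges ?i" "(c2, x) \<notin> cube_edges ?i"
    "\<not> agree ?k c1 x \<or> \<not> agree ?k c2 x"
    using I unfolding I_def by blast
  obtain c1' c2' where c': "C' = [c1', c2']" "(c1, c1') \<in> cube_edges ?i" "(c2, c2') \<in> cube_edges ?i"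
    using move by (auto simp: c(1) list_all2_Cons1 snapshot_at_cube)
  \<comment> \<open>At most one cop agrees in coordinate \<open>?k\<close>; if there is one,
    \<open>c0\<close> is its new vertex. The robber makes \<open>c0\<close> differ in
    \<open>?i\<close>, while the other cop still differs in \<open>?k\<close>. Round
    \<open>Suc t\<close> plays \<open>?j\<close>, so neither can capture in it.\<close>
  define c0 where "c0 = (if agree ?k c1 x then c1' else c2')"
  obtain y where y: "(x, y) \<in> cube_edges ?i" "\<not> agree ?i y c0"
    using cube_edges_choose[OF c(4), of ?i c0 False] by auto
  have k: "agree ?k c1' y \<longleftrightarrow> agree ?k c1 x" "agree ?k c2' y \<longleftrightarrow> agree ?k c2 x"
    using c' y(1) cube_edges_agree_iff mod3_Suc_neq(2) by blast+
  have i: "\<not> agree ?i c1' y \<or> \<not> agree ?k c1' y" "\<not> agree ?i c2' y \<or> \<not> agree ?k c2' y"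
    "\<not> agree ?i c1' y \<or> \<not> agree ?i c2' y"
    using y(2) c(7) k by (auto simp: c0_def agree_def split: if_splits)
  have subsets: "c1' \<subseteq> {..<3}" "c2' \<subseteq> {..<3}" "y \<subseteq> {..<3}"
    using c' y(1) by (auto dest: cube_edges_subset)
  have "I (Suc t) C' y"
    using c'(1) i subsets cube_edges_iff_agree[of _ y "Suc t"]
    by (auto simp: I_def mod3_Suc_Suc_Suc)
  moreover have "x \<notin> set C'"
    using c c' by auto
  ultimately show "x \<notin> set C' \<and> (\<exists>y. (x, y) \<in> snapshot_at cube t \<and> I (Suc t) C' y)"
    using y(1) by (auto simp: snapshot_at_cube)
qed

section \<open>The cop number of the cube and the minimum\<close>

lemma cop_number_cube: "cop_number cube = 3"
  unfolding cop_number_def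
proof (rule Least_equality)
  fix k
  assume k: "\<exists>S. winning_strategy cube k S"
  show "3 \<le> k"
  proof (rule ccontr)
    assume "\<not> 3 \<le> k"
    then have "k \<le> 2" by simp
    with k show False
      using winning_strategy_mono[OF is_periodic_graph_cube] two_cops_lose_cube by blast
  qed
qed (rule three_cops_win_cube)

text \<open>Finite vertex sets embed into \<open>nat\<close>, so graphs over any type are
  represented there.\<close>

lemma ex_nat_periodic_graph:
  assumes G: "is_periodic_graph (G :: 'v periodic_graph)"
  shows "\<exists>H :: nat periodic_graph. is_periodic_graph H \<and>
    cop_number H = cop_number G \<and> card (verts H) = card (verts G)"
proof -
  obtain f :: "'v \<Rightarrow> nat" where f: "inj_on f (verts G)"
    using finite_imp_inj_to_nat_seg[of "verts G"] G by (auto simp: is_periodic_graph_def)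
  have "card (verts (relabel f G)) = card (verts G)"
    using f by (simp add: relabel_def card_image)
  then show ?thesis
    using is_periodic_graph_relabel[OF G] cop_number_relabel[OF G f] by blast
qed

theorem theorem1:
  "\<exists>m. (\<exists>G :: nat periodic_graph.
          is_periodic_graph G \<and> cop_number G = 3 \<and> card (verts G) = m) \<and>
       (\<forall>G :: 'v periodic_graph.
          is_periodic_graph G \<and> cop_number G = 3 \<longrightarrow> m \<le> card (verts G)) \<and>
       5 \<le> m \<and> m \<le> 8"
proof -
  \<comment> \<open>The minimum is taken over graphs on \<open>nat\<close>;
    \<open>ex_nat_periodic_graph\<close> brings in the cube and compares the minimum with graphs on
    \<open>'v\<close>.\<close>
  define P where "P m \<longleftrightarrow> (\<exists>G :: nat periodic_graph.
      is_periodic_graph G \<and> cop_number G = 3 \<and> card (verts G) = m)" for m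
  have "card (verts cube) = 8"
    by (simp add: cube_def card_Pow)
  then have P8: "P 8"
    using ex_nat_periodic_graph[OF is_periodic_graph_cube] cop_number_cube
    unfolding P_def by metis
  have five: "5 \<le> m" if P: "P m" for m
  proof (rule ccontr)
    assume "\<not> 5 \<le> m"
    with P obtain G :: "nat periodic_graph" where
      G: "is_periodic_graph G" "cop_number G = 3" "card (verts G) \<le> 4"
      by (auto simp: P_def)
    have "cop_number G \<le> 2"
      unfolding cop_number_def using two_cops_win_if_card_le_4[OF G(1,3)] by (rule Least_le)
    with G(2) show False by simp
  qed
  have "(LEAST m. P m) \<le> card (verts G)" if "is_periodic_graph G" "cop_number G = 3"
    for G :: "'v periodic_graph"
    using ex_nat_periodic_graph[OF that(1)] that(2) unfolding P_def by (auto intro: Least_le)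
  moreover have "P (LEAST m. P m)"
    using P8 by (rule LeastI)
  moreover have "(LEAST m. P m) \<le> 8"
    using P8 by (rule Least_le)
  ultimately show ?thesis
    using five unfolding P_def by blast
qed

end
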